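(* Let $\gamma=\begin{pmatrix}a&b\\c&d\end{pmatrix}\in\mathrm{SL}_2(\mathbb{Z})$ with $c>0$ and $\ell_\gamma:=\gcd(c,a-1)>1$, let $x=(x_1,0)\in\mathbb{Q}^2$ with $x_1\in\ell_\gamma^{-1}\mathbb{Z}\smallsetminus\mathbb{Z}$, and let $\omega\in\mathrm{M}_{2\times1}^{\mathrm{Irr}}(\mathbb{R})$. Then $$\mathfrak{Z}_0(\gamma)(x,\omega)-\mathfrak{Z}_0(\gamma)(\ell_\gamma x,\ell_\gamma^{-1}\omega)=\Big(\sum_{\lambda\in\mathbb{Z}^2}w_{\gamma,x}(\lambda)\Big)-\mathrm{area}(T_{\gamma,x})+\frac{\mathrm{sgn}(a+c\tau)-3}{4},$$ where $\tau:=\omega_2/\omega_1$, and $w_{\gamma,x}$ is the real-valued function on $\mathbb{R}^2$ with support $T_{\gamma,x}$ such that $w_{\gamma,x}$ equals $1$ on the interior of $T_{\gamma,x}$ and $1/2$ on its boundary (and $0$ outside $T_{\gamma,x}$).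
   Context: $\mathrm{M}_{2\times1}^{\mathrm{Irr}}(\mathbb{R})$ is the set of column vectors $\omega=(\omega_1,\omega_2)^{\mathrm T}\in\mathbb{R}^2$ whose entries are linearly independent over $\mathbb{Q}$. For $y\in\mathbb{R}$, $\{y\}=y-\lfloor y\rfloor$; $\mathbf{1}_{\mathbb{Z}}$ is the indicator function of $\mathbb{Z}$. $T_\gamma$ (for $c\ne0$) is the triangle in $\mathbb{R}^2$ with vertices $(0,0)$, $(a-1,c)$, $(-1,0)$, and $T_{\gamma,x}:=\{x_1\}T_\gamma$ is its dilation by the fractional part of $x_1$. $\bar B_2(y):=\{y\}^2-\{y\}+1/6$; $\bar B_1(y):=0$ if $y\in\mathbb{Z}$ and $\bar B_1(y):=\{y\}-1/2$ if $y\notin\mathbb{Z}$. For $a,c\in\mathbb{Z}$, $c\neq0$, $x\in\mathbb{R}^2$, $$S(a,c;x)=\sum_{m\in\mathbb{Z}/c\mathbb{Z}}\bar B_1\Big(x_1+(x_2+m)\frac ac\Big)\bar B_1\Big((x_2+m)\frac1c\Big).$$ For an integer matrix $\gamma=\begin{pmatrix}a&b\\c&d\end{pmatrix}$ with nonzero determinant, $x\in\mathbb{Q}^2$ and $\omega\in\mathrm{M}_{2\times1}^{\mathrm{Irr}}(\mathbb{R})$, $\mathfrak{Z}_0(\gamma)(x,\omega):=0$ if $c=0$, and otherwise, with $\tau:=\omega_2/\omega_1$, $$\mathfrak{Z}_0(\gamma)(x,\omega):=\frac{\gcd(a,c)^2}{2c(a+c\tau)}\bar B_2\Big(\frac{c}{\gcd(a,c)}x_1-\frac{a}{\gcd(a,c)}x_2\Big)+\frac{a+c\tau}{2c}\bar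 B_2(x_2)+\mathrm{sgn}(c)S(-a,c;x)-\frac{\mathrm{sgn}(c(a+c\tau))}{4}\mathbf{1}_{\mathbb{Z}}(x_1)\mathbf{1}_{\mathbb{Z}}(x_2).$$ *)

theory Defs
  imports "HOL-Analysis.Analysis"
begin

text \<open>Vectors \<open>(\<omega>\<^sub>1, \<omega>\<^sub>2)\<close> whose entries are linearly independent over \<open>\<rat>\<close>. Independence is
  that of a family, so in particular the two entries are distinct.\<close>

definition irr_vecs :: "(real ^ 2) set" where
  "irr_vecs = {\<omega>. \<forall>p q :: rat.
     of_rat p * \<omega> $ 1 + of_rat q * \<omega> $ 2 = 0 \<longrightarrow> p = 0 \<and> q = 0}"

definition SL2Z :: "(int ^ 2 ^ 2) set" where
  "SL2Z = {\<gamma>. det \<gamma> = 1}"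

definition B1_per :: "real \<Rightarrow> real" where
  "B1_per y = (if y \<in> \<int> then 0 else frac y - 1 / 2)"

definition B2_per :: "real \<Rightarrow> real" where
  "B2_per y = (frac y)\<^sup>2 - frac y + 1 / 6"

text \<open>The generalized Dedekind sum. The summand depends only on \<open>m\<close> modulo \<open>c\<close> (replacing \<open>m\<close> by
  \<open>m + c\<close> shifts the two arguments by the integers \<open>a\<close> and \<open>1\<close>), so the sum over \<open>\<int>/c\<int>\<close> is taken
  over the representatives \<open>0, \<dots>, \<bar>c\<bar> - 1\<close>.\<close>

definition dedekind_S :: "int \<Rightarrow> int \<Rightarrow> real ^ 2 \<Rightarrow> real" where
  "dedekind_S a c x =
     (\<Sum>m\<in>{0..<\<bar>c\<bar>}. B1_per (x $ 1 + (x $ 2 + of_int m) * (of_int a / of_int c))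
                    * B1_per ((x $ 2 + of_int m) * (1 / of_int c)))"

text \<open>Of interest for \<open>det \<gamma> \<noteq> 0\<close>, \<open>x \<in> \<rat>\<^sup>2\<close> and \<open>\<omega> \<in> irr_vecs\<close>. In that case \<open>\<omega> $ 1 \<noteq> 0\<close>, and
  \<open>a + c\<tau> \<noteq> 0\<close> whenever \<open>c \<noteq> 0\<close>, so all divisions are proper.\<close>

definition Z0 :: "int ^ 2 ^ 2 \<Rightarrow> real ^ 2 \<Rightarrow> real ^ 2 \<Rightarrow> real" where
  "Z0 \<gamma> x \<omega> =
     (let a = \<gamma> $ 1 $ 1; c = \<gamma> $ 2 $ 1; \<tau> = \<omega> $ 2 / \<omega> $ 1; g = real_of_int (gcd a c);
          j = real_of_int a + real_of_int c * \<tau>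
      in if c = 0 then 0
         else g\<^sup>2 / (2 * real_of_int c * j)
                * B2_per (real_of_int c / g * x $ 1 - real_of_int a / g * x $ 2)
              + j / (2 * real_of_int c) * B2_per (x $ 2)
              + real_of_int (sgn c) * dedekind_S (- a) c x
              - sgn (real_of_int c * j) / 4 * indicator \<int> (x $ 1) * indicator \<int> (x $ 2))"

definition ell :: "int ^ 2 ^ 2 \<Rightarrow> int" where
  "ell \<gamma> = gcd (\<gamma> $ 2 $ 1) (\<gamma> $ 1 $ 1 - 1)"

definition triangle :: "int ^ 2 ^ 2 \<Rightarrow> (real ^ 2) set" where
  "triangle \<gamma> = convex hull
     {vector [0, 0], vector [of_int (\<gamma> $ 1 $ 1 - 1), of_int (\<gamma> $ 2 $ 1)], vector [-1, 0]}"

definition triangle_dil :: "int ^ 2 ^ 2 \<Rightarrow> real ^ 2 \<Rightarrow> (real ^ 2) set" where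
  "triangle_dil \<gamma> x = (\<lambda>v. frac (x $ 1) *\<^sub>R v) ` triangle \<gamma>"

definition weight :: "int ^ 2 ^ 2 \<Rightarrow> real ^ 2 \<Rightarrow> real ^ 2 \<Rightarrow> real" where
  "weight \<gamma> x v =
     (if v \<in> interior (triangle_dil \<gamma> x) then 1
      else if v \<in> frontier (triangle_dil \<gamma> x) then 1 / 2
      else 0)"

definition lattice_Z2 :: "(real ^ 2) set" where
  "lattice_Z2 = {v. \<forall>i. v $ i \<in> \<int>}"

end

theory Submission
  imports Defs
begin

text \<open>
  Since \<open>\<ell> = gcd (c, a - 1)\<close> divides \<open>c\<close>, the numbers \<open>c x\<^sub>1\<close>, \<open>c \<ell> x\<^sub>1\<close> and \<open>\<ell> x\<^sub>1\<close> are integers,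
  while \<open>\<tau>\<close> does not change when \<open>\<omega>\<close> is scaled. So the two \<open>B\<^sub>2\<close> terms cancel in the difference
  of the values of \<open>Z0\<close>, the indicator term contributes \<open>sgn (a + c\<tau>) / 4\<close>, and what is left is the
  variation \<open>S(-a,c;x) - S(-a,c;0)\<close> of a Dedekind sum. Write \<open>t = {x\<^sub>1} = K / c\<close> with an integer
  \<open>0 < K < c\<close>, and \<open>f(n) = B\<^sub>1(na/c)\<close>. Divisibility of \<open>a - 1\<close> by \<open>\<ell>\<close> gives \<open>Ka \<equiv> K (mod c)\<close>, and
  everything rests on this congruence: it turns the translate \<open>B\<^sub>1(na/c - t)\<close> into \<open>f(n - K)\<close>.

  On the arithmetic side, shifting the summation variable by \<open>K\<close> moves the translation from \<open>f\<close> to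
  the other factor \<open>B\<^sub>1(m/c)\<close>. As \<open>m\<close> runs through \<open>0 < m < c\<close>, the difference
  \<open>B\<^sub>1(m/c) - B\<^sub>1((m+K)/c)\<close> is the constant \<open>-t\<close>, up to a jump by one at \<open>m = c - K\<close> (taken
  with half weight there). The constant pairs to zero with the odd periodic \<open>f\<close>, and the jump leaves
  a sum of \<open>f\<close> over an interval: the variation equals \<open>(t - 1/2)/2 - f(0) - \<dots> - f(K)\<close>
  (\<open>dedekind_sum_variation\<close>).

  On the geometric side, the dilated triangle meets the line at height \<open>n\<close> in the interval
  \<open>[na/c - t, n(a-1)/c]\<close>, and the half-weighted number of integers in an interval \<open>[u, v]\<close> is
  \<open>v - u - B\<^sub>1(v) + B\<^sub>1(u)\<close> (\<open>sum_half_weighted_ints\<close>). Summed over the heights \<open>0, \<dots>, K\<close>, the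
  lengths give the area plus \<open>t/2\<close>, the right endpoints cancel under \<open>n \<mapsto> K - n\<close>, and the left
  endpoints give the same sum \<open>-f(0) - \<dots> - f(K)\<close> (\<open>sum_rows\<close>). The apex at height \<open>K\<close>, where
  the interval is a single lattice point, accounts for an extra \<open>1/2\<close> (\<open>infsum_weight\<close>). The two
  sides then differ by the constant \<open>3/4\<close>.
\<close>

section \<open>The sawtooth function\<close>

text \<open>This form needs no case distinction at the integers, and it makes the oddness of the sawtooth
  immediate because negation exchanges floor and ceiling.\<close>

lemma B1_per_floor_ceiling: "B1_per y = y - (of_int \<lfloor>y\<rfloor> + of_int \<lceil>y\<rceil>) / 2"
proof (cases "y \<in> \<int>")
  case True
  then show ?thesis by (auto simp: B1_per_def elim!: Ints_cases)
next
  case False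
  then have "\<lceil>y\<rceil> = \<lfloor>y\<rfloor> + 1"
    by (simp add: ceiling_altdef) (metis Ints_of_int)
  then show ?thesis using False by (simp add: B1_per_def frac_def field_simps)
qed

lemma B1_per_minus: "B1_per (- y) = - B1_per y"
  unfolding B1_per_floor_ceiling by (simp add: ceiling_def field_simps)

lemma B1_per_add_int: "B1_per (y + of_int k) = B1_per y"
  unfolding B1_per_floor_ceiling by (simp add: field_simps)

lemma B1_per_of_int [simp]: "B1_per (of_int k) = 0"
  by (simp add: B1_per_def)

lemma B1_per_0 [simp]: "B1_per 0 = 0"
  by (simp add: B1_per_def)

lemma B1_per_unit_interval: "0 < y \<Longrightarrow> y < 1 \<Longrightarrow> B1_per y = y - 1 / 2"
  by (subgoal_tac "frac y = y") (auto simp: B1_per_def frac_eq elim!: Ints_cases)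

text \<open>The weight of an integer is the mean of the indicators of the closed and of the open interval.
  These have \<open>\<lfloor>v\<rfloor> - \<lceil>u\<rceil> + 1\<close> and \<open>\<lceil>v\<rceil> - \<lfloor>u\<rfloor> - 1\<close> integers, and the mean of the two counts is
  the difference of the values of \<open>(\<lfloor>y\<rfloor> + \<lceil>y\<rceil>) / 2 = y - B\<^sub>1(y)\<close> at the endpoints. For \<open>u = v\<close> an
  integer the formula fails: it gives \<open>0\<close> where the sum is \<open>1/2\<close>.\<close>

lemma sum_half_weighted_ints:
  fixes u v :: real
  assumes "u < v"
  shows "(\<Sum>m\<in>{\<lceil>u\<rceil>..\<lfloor>v\<rfloor>}. if u < of_int m \<and> of_int m < v then 1 else 1 / 2)
       = v - u - B1_per v + B1_per u"
proof -
  let ?A = "{\<lceil>u\<rceil>..\<lfloor>v\<rfloor>}" and ?B = "{\<lfloor>u\<rfloor> + 1..\<lceil>v\<rceil> - 1}"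
  have sub: "?B \<subseteq> ?A" by (auto; linarith)
  have "(\<Sum>m\<in>?A. if u < of_int m \<and> of_int m < v then 1 else 1 / 2)
      = (\<Sum>m\<in>?A. 1 / 2 + (if m \<in> ?B then 1 / 2 else 0 :: real))"
    by (intro sum.cong refl) (auto; linarith)
  also have "\<dots> = of_nat (card ?A) / 2 + of_nat (card ?B) / 2"
  proof -
    have "(\<Sum>m\<in>?A. if m \<in> ?B then 1 / 2 else 0 :: real) = (\<Sum>m\<in>?B. 1 / 2)"
      using sub by (intro sum.mono_neutral_cong_right) auto
    then show ?thesis by (simp only: sum.distrib sum_constant)
  qed
  also have "of_nat (card ?A) = (of_int (\<lfloor>v\<rfloor> - \<lceil>u\<rceil> + 1) :: real)"
  proof -
    have "\<lfloor>v\<rfloor> - \<lceil>u\<rceil> + 1 \<ge> 0" using assms by linarith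
    then show ?thesis by (simp add: algebra_simps)
  qed
  also have "of_nat (card ?B) = (of_int (\<lceil>v\<rceil> - \<lfloor>u\<rfloor> - 1) :: real)"
  proof -
    have "\<lceil>v\<rceil> - \<lfloor>u\<rfloor> - 1 \<ge> 0" using assms by linarith
    then show ?thesis by (simp add: algebra_simps)
  qed
  finally show ?thesis by (simp add: B1_per_floor_ceiling field_simps)
qed

section \<open>The variation of the Dedekind sum\<close>

text \<open>A translation or a reflection permutes the residues modulo \<open>c\<close>.\<close>

lemma sum_periodic_affine:
  fixes g :: "int \<Rightarrow> 'a::comm_monoid_add" and c e k :: int
  assumes c: "c > 0" and e: "e * e = 1" and per: "\<And>m j. g (m + c * j) = g m"
  shows "(\<Sum>m\<in>{0..<c}. g (e * m + k)) = (\<Sum>m\<in>{0..<c}. g m)"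
proof -
  have gmod: "g (m mod c) = g m" for m
    using per[of "m mod c" "m div c"] by simp
  have inv1: "(e * ((e * m + k) mod c - k)) mod c = m" if "m \<in> {0..<c}" for m
  proof -
    have "(e * ((e * m + k) mod c - k)) mod c = (e * (e * m + k - k)) mod c"
      by (metis mod_diff_left_eq mod_mult_right_eq)
    also have "e * (e * m + k - k) = m" using e by (simp flip: mult.assoc)
    finally show ?thesis using that by simp
  qed
  have inv2: "(e * ((e * (m - k)) mod c) + k) mod c = m" if "m \<in> {0..<c}" for m
  proof -
    have "(e * ((e * (m - k)) mod c) + k) mod c = (e * (e * (m - k)) + k) mod c"
      by (metis mod_add_left_eq mod_mult_right_eq)
    also have "e * (e * (m - k)) + k = m" using e by (simp flip: mult.assoc)
    finally show ?thesis using that by simp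
  qed
  show ?thesis
    by (rule sum.reindex_bij_witness[of _ "\<lambda>m. (e * (m - k)) mod c" "\<lambda>m. (e * m + k) mod c"])
       (use c inv1 inv2 in \<open>simp_all add: gmod\<close>)
qed

context
  fixes a c K :: int and f :: "int \<Rightarrow> real"
  assumes c: "c > 0" and K: "0 < K" "K < c" and dvd: "c dvd K * (a - 1)"
  defines "f \<equiv> \<lambda>n. B1_per (of_int (n * a) / of_int c)"
begin

lemma sawtooth_periodic: "f (m + c * j) = f m"
  using B1_per_add_int[of "of_int (m * a) / of_int c" "j * a"] c
  by (simp add: f_def field_simps)

lemma sawtooth_odd: "f (- m) = - f m"
  using B1_per_minus[of "of_int (m * a) / of_int c"] by (simp add: f_def)

text \<open>Here the congruence \<open>Ka \<equiv> K (mod c)\<close> enters: \<open>na - K\<close> and \<open>(n - K)a\<close> agree modulo \<open>c\<close>.\<close>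

lemma sawtooth_shift: "f (n - K) = B1_per (of_int (n * a - K) / of_int c)"
proof -
  obtain q where q: "K * (a - 1) = c * q" using dvd by blast
  have "n * a - K = (n - K) * a + c * q" by (simp add: q[symmetric] algebra_simps)
  then have "of_int (n * a - K) / of_int c = of_int ((n - K) * a) / of_int c + (of_int q :: real)"
    using c by (simp add: field_simps flip: of_int_mult of_int_add of_int_diff)
  then show ?thesis by (simp add: f_def B1_per_add_int)
qed

lemma sawtooth_at_K: "f K = of_int K / of_int c - 1 / 2"
proof -
  have "f (- K) = B1_per (- (of_int K / of_int c))" using sawtooth_shift[of 0] by simp
  then have "f K = B1_per (of_int K / of_int c)" by (simp add: sawtooth_odd B1_per_minus)
  then show ?thesis using K by (simp add: B1_per_unit_interval)
qed

lemma sum_sawtooth_period: "(\<Sum>m\<in>{0..<c}. f m) = 0"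
proof -
  have "(\<Sum>m\<in>{0..<c}. f (- 1 * m + 0)) = (\<Sum>m\<in>{0..<c}. f m)"
    by (rule sum_periodic_affine) (use c sawtooth_periodic in auto)
  then show ?thesis by (simp add: sawtooth_odd sum_negf)
qed

text \<open>The shift by \<open>K / c < 1\<close> crosses the integer \<open>1\<close> exactly when \<open>m + K > c\<close> and lands on it when
  \<open>m + K = c\<close>, where the sawtooth takes the mean of its one-sided limits.\<close>

lemma B1_per_shift_difference:
  assumes "0 < m" "m < c"
  shows "B1_per (of_int m / of_int c) - B1_per (of_int (m + K) / of_int c)
       = (if c - K \<le> m then 1 else 0) - (if m = c - K then 1 / 2 else 0) - of_int K / of_int c"
proof -
  have m: "B1_per (of_int m / of_int c) = of_int m / of_int c - 1 / 2"
    using assms by (simp add: B1_per_unit_interval)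
  consider "m + K < c" | "m + K = c" | "m + K > c" by linarith
  then show ?thesis
  proof cases
    case 1
    then have "B1_per (of_int (m + K) / of_int c) = of_int (m + K) / of_int c - 1 / 2"
      using assms K by (intro B1_per_unit_interval) (auto simp flip: of_int_add)
    then show ?thesis using 1 m c by (simp add: field_simps)
  next
    case 2
    have "B1_per (of_int (m + K) / of_int c) = 0" using B1_per_of_int[of 1] c by (simp add: 2)
    moreover have "m = c - K" using 2 by simp
    ultimately show ?thesis using m c by (simp add: field_simps)
  next
    case 3
    have "B1_per (of_int (m + K) / of_int c) = B1_per (of_int (m + K - c) / of_int c)"
      using B1_per_add_int[of "of_int (m + K - c) / of_int c" 1] c by (simp add: field_simps)
    also have "\<dots> = of_int (m + K - c) / of_int c - 1 / 2"
      using assms K 3 by (intro B1_per_unit_interval)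
        (auto simp: divide_less_eq zero_less_divide_iff simp flip: of_int_add of_int_diff)
    finally show ?thesis using 3 m c by (simp add: field_simps)
  qed
qed

text \<open>Moving the shift by \<open>K\<close> onto the second factor leaves \<open>f\<close> paired with a step function.\<close>

lemma dedekind_sum_variation:
  "(\<Sum>m\<in>{0..<c}. (f m - f (m - K)) * B1_per (of_int m / of_int c))
     = (of_int K / of_int c - 1 / 2) / 2 - (\<Sum>n\<in>{0..K}. f n)"
proof -
  define g where "g = (\<lambda>m. f (m - K) * B1_per (of_int m / of_int c))"
  have g_per: "g (m + c * j) = g m" for m j
    using sawtooth_periodic[of "m - K" j] B1_per_add_int[of "of_int m / of_int c" j] c
    by (simp add: g_def field_simps)
  have shift: "(\<Sum>m\<in>{0..<c}. g m) = (\<Sum>m\<in>{0..<c}. f m * B1_per (of_int (m + K) / of_int c))"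
    using sum_periodic_affine[of c 1 g K] c g_per by (simp add: g_def)
  have summand: "f m * (B1_per (of_int m / of_int c) - B1_per (of_int (m + K) / of_int c))
      = (if c - K \<le> m then f m else 0) - (if m = c - K then f m / 2 else 0)
        - of_int K / of_int c * f m" if "m \<in> {0..<c}" for m
  proof (cases "m = 0")
    case True
    then show ?thesis using K by (simp add: f_def)
  next
    case False
    then have "0 < m" "m < c" using that by auto
    then show ?thesis by (subst B1_per_shift_difference) (auto simp: algebra_simps)
  qed
  have "(\<Sum>m\<in>{0..<c}. (f m - f (m - K)) * B1_per (of_int m / of_int c))
      = (\<Sum>m\<in>{0..<c}. f m * B1_per (of_int m / of_int c)) - (\<Sum>m\<in>{0..<c}. g m)"
    by (simp add: g_def left_diff_distrib sum_subtractf)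
  also have "\<dots> = (\<Sum>m\<in>{0..<c}. f m * (B1_per (of_int m / of_int c) - B1_per (of_int (m + K) / of_int c)))"
    unfolding shift by (simp add: right_diff_distrib sum_subtractf)
  also have "\<dots> = (\<Sum>m\<in>{0..<c}. if c - K \<le> m then f m else 0)
      - (\<Sum>m\<in>{0..<c}. if m = c - K then f m / 2 else 0) - of_int K / of_int c * (\<Sum>m\<in>{0..<c}. f m)"
    unfolding sum_distrib_left sum_subtractf[symmetric] by (intro sum.cong refl summand)
  also have "(\<Sum>m\<in>{0..<c}. if m = c - K then f m / 2 else 0) = f (c - K) / 2"
    using K by (subst sum.delta) auto
  also have "f (c - K) = - f K" using sawtooth_periodic[of "- K" 1] by (simp add: sawtooth_odd)
  also have "(\<Sum>m\<in>{0..<c}. if c - K \<le> m then f m else 0) = (\<Sum>m\<in>{c - K..<c}. f m)"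
    using K by (intro sum.mono_neutral_cong_right) auto
  also have "\<dots> = (\<Sum>n\<in>{1..K}. f (c - n))"
    by (rule sum.reindex_bij_witness[of _ "\<lambda>n. c - n" "\<lambda>n. c - n"]) auto
  also have "\<dots> = - (\<Sum>n\<in>{1..K}. f n)"
    using sawtooth_periodic[of _ 1] sawtooth_odd by (simp add: sum_negf[symmetric]) (metis add.commute uminus_add_conv_diff)
  also have "(\<Sum>n\<in>{1..K}. f n) = (\<Sum>n\<in>{0..K}. f n)"
  proof -
    have "{0..K} = insert 0 {1..K}" using K by auto
    then show ?thesis by (simp add: f_def)
  qed
  finally show ?thesis by (simp add: sum_sawtooth_period sawtooth_at_K diff_divide_distrib)
qed

text \<open>The reflection \<open>n \<mapsto> K - n\<close> negates \<open>n(a-1)\<close> modulo \<open>c\<close>, so the right endpoints cancel in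
  pairs; on the left endpoints it reduces \<open>f(n - K)\<close> to \<open>f(-n)\<close>.\<close>

lemma sum_rows:
  "(\<Sum>n\<in>{0..K}. of_int (n * (a - 1)) / of_int c - of_int (n * a - K) / of_int c
      - B1_per (of_int (n * (a - 1)) / of_int c) + B1_per (of_int (n * a - K) / of_int c))
   = of_int (K * (K + 1)) / of_int (2 * c) - (\<Sum>n\<in>{0..K}. f n)"
proof -
  obtain q where q: "K * (a - 1) = c * q" using dvd by blast
  have refl: "(\<Sum>n\<in>{0..K}. h n) = (\<Sum>n\<in>{0..K}. h (K - n))" for h :: "int \<Rightarrow> real"
    by (rule sum.reindex_bij_witness[of _ "\<lambda>n. K - n" "\<lambda>n. K - n"]) auto
  have len: "(\<Sum>n\<in>{0..K}. of_int (n * (a - 1)) / of_int c - of_int (n * a - K) / of_int c)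
      = (of_int (K * (K + 1)) / of_int (2 * c) :: real)" (is "(\<Sum>n\<in>_. ?h n) = _")
  proof -
    \<comment> \<open>The row at height \<open>n\<close> has length \<open>(K - n) / c\<close>, so opposite rows add up to \<open>K / c\<close>.\<close>
    have "2 * (\<Sum>n\<in>{0..K}. ?h n) = (\<Sum>n\<in>{0..K}. ?h n) + (\<Sum>n\<in>{0..K}. ?h (K - n))"
      using refl[of ?h] by simp
    also have "\<dots> = (\<Sum>n\<in>{0..K}. of_int K / of_int c)"
      unfolding sum.distrib[symmetric] using c by (intro sum.cong) (auto simp: field_simps)
    also have "\<dots> = of_int (K * (K + 1)) / of_int c" using K by simp
    finally show ?thesis by (simp add: field_simps)
  qed
  have right: "(\<Sum>n\<in>{0..K}. B1_per (of_int (n * (a - 1)) / of_int c)) = 0" (is "(\<Sum>n\<in>_. ?h n) = _")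
  proof -
    have "?h (K - n) = - ?h n" for n
    proof -
      have "(K - n) * (a - 1) = - (n * (a - 1)) + c * q" by (simp add: q[symmetric] algebra_simps)
      then have "of_int ((K - n) * (a - 1)) / of_int c = - (of_int (n * (a - 1)) / of_int c) + (of_int q :: real)"
        using c by (simp add: field_simps flip: of_int_mult of_int_add of_int_diff)
      then show ?thesis by (simp only: B1_per_add_int B1_per_minus)
    qed
    then show ?thesis using refl[of ?h] by (simp add: sum_negf)
  qed
  have left: "(\<Sum>n\<in>{0..K}. B1_per (of_int (n * a - K) / of_int c)) = - (\<Sum>n\<in>{0..K}. f n)"
  proof -
    have "(\<Sum>n\<in>{0..K}. B1_per (of_int (n * a - K) / of_int c)) = (\<Sum>n\<in>{0..K}. f (K - n - K))"
      using refl[of "\<lambda>n. f (n - K)"] by (simp only: sawtooth_shift)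
    then show ?thesis by (simp add: sawtooth_odd sum_negf)
  qed
  show ?thesis
    unfolding sum.distrib sum_subtractf using len right left by (simp add: sum_subtractf)
qed

end

section \<open>Lattice points in the dilated triangle\<close>

lemma of_int_divide_cmp:
  fixes c m p :: int
  assumes "c > 0"
  shows "(of_int p / of_int c :: real) \<le> of_int m \<longleftrightarrow> p \<le> c * m"
    and "of_int m \<le> (of_int p / of_int c :: real) \<longleftrightarrow> c * m \<le> p"
    and "(of_int p / of_int c :: real) < of_int m \<longleftrightarrow> p < c * m"
    and "of_int m < (of_int p / of_int c :: real) \<longleftrightarrow> c * m < p"
  using assms
  by (simp_all only: pos_divide_le_eq pos_le_divide_eq pos_divide_less_eq pos_less_divide_eq
      of_int_0_less_iff of_int_mult[symmetric] of_int_le_iff of_int_less_iff mult.commute[of m])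

text \<open>The barycentric coordinates of a point at the second and third vertex are \<open>q\<close> and \<open>r\<close> below. Up
  to positive factors, all three coordinates are the defining linear forms of the half-planes.\<close>

lemma convex_hull_triangle_halfplanes:
  fixes a c t :: real
  assumes "c > 0" "t > 0"
  shows "convex hull {vector [0, 0], vector [t * (a - 1), t * c], vector [- t, 0]}
       = {v :: real ^ 2. 0 \<le> v $ 2 \<and> a * v $ 2 - c * t \<le> c * v $ 1 \<and> c * v $ 1 \<le> (a - 1) * v $ 2}"
    (is "?L = ?R")
proof (intro equalityI subsetI)
  fix v assume "v \<in> ?L"
  then obtain p q r where pqr: "0 \<le> p" "0 \<le> q" "0 \<le> r" "p + q + r = 1"
    and v: "v = p *\<^sub>R vector [0, 0] + q *\<^sub>R vector [t * (a - 1), t * c] + r *\<^sub>R vector [- t, 0]"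
    unfolding convex_hull_3 by blast
  have v1: "v $ 1 = q * (t * (a - 1)) - r * t" and v2: "v $ 2 = q * (t * c)" by (simp_all add: v)
  have "c * v $ 1 - (a * v $ 2 - c * t) = c * t * (1 - q - r)" by (simp add: v1 v2 algebra_simps)
  also have "\<dots> \<ge> 0" using pqr assms by simp
  finally have "a * v $ 2 - c * t \<le> c * v $ 1" by simp
  moreover have "(a - 1) * v $ 2 - c * v $ 1 = c * t * r" by (simp add: v1 v2 algebra_simps)
  then have "c * v $ 1 \<le> (a - 1) * v $ 2"
    using pqr assms by (metis diff_ge_0_iff_ge less_imp_le mult_nonneg_nonneg)
  ultimately show "v \<in> ?R" using v2 pqr assms by simp
next
  fix v assume v: "v \<in> ?R"
  \<comment> \<open>The value of \<open>q\<close> is forced by the height, and then that of \<open>r\<close> by the abscissa.\<close>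
  define q r where "q = v $ 2 / (t * c)" and "r = ((a - 1) * v $ 2 - c * v $ 1) / (t * c)"
  have "0 \<le> q" "0 \<le> r" using v assms by (simp_all add: q_def r_def)
  moreover have "1 - q - r = (c * t - a * v $ 2 + c * v $ 1) / (t * c)"
    using assms by (simp add: q_def r_def field_simps)
  then have "0 \<le> 1 - q - r" using v assms by simp
  moreover have "v = (1 - q - r) *\<^sub>R vector [0, 0] + q *\<^sub>R vector [t * (a - 1), t * c] + r *\<^sub>R vector [- t, 0]"
    using assms by (simp add: vec_eq_iff forall_2 q_def r_def field_simps)
  ultimately show "v \<in> ?L"
    unfolding convex_hull_3 by (smt (verit) mem_Collect_eq)
qed

lemma interior_triangle_halfplanes:
  fixes a c s :: real
  assumes "c > 0"
  shows "interior {v :: real ^ 2. 0 \<le> v $ 2 \<and> a * v $ 2 - s \<le> c * v $ 1 \<and> c * v $ 1 \<le> (a - 1) * v $ 2}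
       = {v. 0 < v $ 2 \<and> a * v $ 2 - s < c * v $ 1 \<and> c * v $ 1 < (a - 1) * v $ 2}"
proof -
  let ?p = "vector [- c, a] :: real ^ 2" and ?q = "vector [c, 1 - a] :: real ^ 2"
  have nz: "?p \<noteq> 0" "?q \<noteq> 0" using assms by (auto simp: vec_eq_iff forall_2)
  have halfplanes: "{v :: real ^ 2. 0 \<le> v $ 2 \<and> a * v $ 2 - s \<le> c * v $ 1 \<and> c * v $ 1 \<le> (a - 1) * v $ 2}
      = {v. v $ 2 \<ge> 0} \<inter> {v. ?p \<bullet> v \<le> s} \<inter> {v. ?q \<bullet> v \<le> 0}"
    by (auto simp: inner_vec_def sum_2 algebra_simps)
  show ?thesis
    unfolding halfplanes interior_Int interior_halfspace_component_ge
      interior_halfspace_le[OF nz(1)] interior_halfspace_le[OF nz(2)]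
    by (auto simp: inner_vec_def sum_2 algebra_simps)
qed

context
  fixes a c K :: int and \<gamma> :: "int ^ 2 ^ 2" and x :: "real ^ 2"
  assumes \<gamma>: "\<gamma> $ 1 $ 1 = a" "\<gamma> $ 2 $ 1 = c"
    and c: "c > 0" and K: "K > 0" and frac_x: "frac (x $ 1) = of_int K / of_int c"
begin

text \<open>The uncancelled product \<open>K / c * c\<close> is the shape \<open>t * c\<close> to which
  \<open>convex_hull_triangle_halfplanes\<close> applies.\<close>

lemma triangle_dil_eq_hull:
  "triangle_dil \<gamma> x = convex hull {vector [0, 0],
     vector [of_int K / of_int c * (of_int a - 1), of_int K / of_int c * of_int c], vector [- (of_int K / of_int c), 0]}"
proof -
  have "(*\<^sub>R) (of_int K / of_int c) ` {vector [0, 0], vector [of_int (a - 1), of_int c], vector [-1, 0]}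
     = {vector [0, 0], vector [of_int K / of_int c * (of_int a - 1), of_int K / of_int c * of_int c],
        vector [- (of_int K / of_int c), 0] :: real ^ 2}"
  proof -
    have "(of_int K / of_int c) *\<^sub>R vector [p, q] = (vector [of_int K / of_int c * p, of_int K / of_int c * q] :: real ^ 2)" for p q
      by (simp add: vec_eq_iff forall_2)
    then show ?thesis by simp
  qed
  then show ?thesis
    unfolding triangle_dil_def triangle_def frac_x \<gamma> convex_hull_scaling[symmetric] by simp
qed

lemma measure_triangle_dil:
  "measure lebesgue (triangle_dil \<gamma> x) = (of_int K)\<^sup>2 / (2 * of_int c)"
proof -
  have "compact (triangle_dil \<gamma> x)"
    unfolding triangle_dil_eq_hull by (intro finite_imp_compact_convex_hull) auto
  then have "measure lebesgue (triangle_dil \<gamma> x) = measure lborel (triangle_dil \<gamma> x)"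
    by (intro measure_completion) (simp add: borel_compact)
  then show ?thesis
    unfolding triangle_dil_eq_hull content_triangle
    using c K by (simp add: power2_eq_square abs_mult)
qed

text \<open>Clearing the denominator \<open>c\<close> turns the membership conditions at lattice points into integer
  inequalities, which are the ones that cut out the rows of \<open>infsum_weight_rows\<close>.\<close>

lemma weight_lattice_point:
  "weight \<gamma> x (vector [of_int m, of_int n]) =
     (if 0 < n \<and> n * a - K < c * m \<and> c * m < n * (a - 1) then 1
      else if 0 \<le> n \<and> n * a - K \<le> c * m \<and> c * m \<le> n * (a - 1) then 1 / 2 else 0)"
proof -
  have T: "triangle_dil \<gamma> x = {v. 0 \<le> v $ 2 \<and> of_int a * v $ 2 - of_int K \<le> of_int c * v $ 1
      \<and> of_int c * v $ 1 \<le> (of_int a - 1) * v $ 2}"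
    unfolding triangle_dil_eq_hull using c K by (subst convex_hull_triangle_halfplanes) auto
  have int: "interior (triangle_dil \<gamma> x) = {v. 0 < v $ 2 \<and> of_int a * v $ 2 - of_int K < of_int c * v $ 1
      \<and> of_int c * v $ 1 < (of_int a - 1) * v $ 2}"
    unfolding T using c by (intro interior_triangle_halfplanes) auto
  have "closed (triangle_dil \<gamma> x)"
    unfolding triangle_dil_eq_hull by (intro compact_imp_closed finite_imp_compact_convex_hull) auto
  then have fr: "frontier (triangle_dil \<gamma> x) = triangle_dil \<gamma> x - interior (triangle_dil \<gamma> x)"
    by (simp add: frontier_def)
  have le: "real_of_int a * of_int n - of_int K \<le> of_int c * of_int m \<longleftrightarrow> n * a - K \<le> c * m"
    "real_of_int c * of_int m \<le> (of_int a - 1) * of_int n \<longleftrightarrow> c * m \<le> n * (a - 1)"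
    "real_of_int a * of_int n - of_int K < of_int c * of_int m \<longleftrightarrow> n * a - K < c * m"
    "real_of_int c * of_int m < (of_int a - 1) * of_int n \<longleftrightarrow> c * m < n * (a - 1)"
  proof -
    have "real_of_int a * of_int n - of_int K = of_int (n * a - K)"
      "(of_int a - 1) * of_int n = real_of_int (n * (a - 1))"
      "real_of_int c * of_int m = of_int (c * m)"
      by simp_all
    then show
      "real_of_int a * of_int n - of_int K \<le> of_int c * of_int m \<longleftrightarrow> n * a - K \<le> c * m"
      "real_of_int c * of_int m \<le> (of_int a - 1) * of_int n \<longleftrightarrow> c * m \<le> n * (a - 1)"
      "real_of_int a * of_int n - of_int K < of_int c * of_int m \<longleftrightarrow> n * a - K < c * m"
      "real_of_int c * of_int m < (of_int a - 1) * of_int n \<longleftrightarrow> c * m < n * (a - 1)"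
      by (simp_all only: of_int_le_iff of_int_less_iff)
  qed
  show ?thesis
    unfolding weight_def fr unfolding int unfolding T by (simp add: le)
qed

text \<open>The support is finite because the two slanted sides meet at height \<open>K\<close>.\<close>

lemma infsum_weight_rows:
  "(\<Sum>\<^sub>\<infinity>v\<in>lattice_Z2. weight \<gamma> x v)
   = (\<Sum>n\<in>{0..K}. \<Sum>m\<in>{\<lceil>of_int (n * a - K) / of_int c :: real\<rceil>..\<lfloor>of_int (n * (a - 1)) / of_int c :: real\<rfloor>}.
        weight \<gamma> x (vector [of_int m, of_int n]))" (is "_ = (\<Sum>n\<in>_. \<Sum>m\<in>?R n. _)")
proof -
  let ?p = "\<lambda>(n, m). vector [real_of_int m, of_int n] :: real ^ 2"
  have mem: "m \<in> ?R n \<longleftrightarrow> n * a - K \<le> c * m \<and> c * m \<le> n * (a - 1)" for m n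
    using c by (simp only: atLeastAtMost_iff ceiling_le_iff le_floor_iff of_int_divide_cmp)
  have bij: "bij_betw ?p UNIV lattice_Z2"
  proof (rule bij_betwI[where g = "\<lambda>v. (\<lfloor>v $ 2\<rfloor>, \<lfloor>v $ 1\<rfloor>)"])
    show "?p \<in> UNIV \<rightarrow> lattice_Z2" by (auto simp: lattice_Z2_def forall_2)
  qed (auto simp: lattice_Z2_def forall_2 vec_eq_iff elim!: Ints_cases)
  have "(\<Sum>\<^sub>\<infinity>v\<in>lattice_Z2. weight \<gamma> x v) = (\<Sum>\<^sub>\<infinity>i\<in>UNIV. weight \<gamma> x (?p i))"
    by (rule infsum_reindex_bij_betw[OF bij, symmetric])
  also have "\<dots> = (\<Sum>\<^sub>\<infinity>i\<in>Sigma {0..K} ?R. weight \<gamma> x (?p i))"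
  proof (rule infsum_cong_neutral)
    fix i assume i: "i \<in> UNIV - Sigma {0..K} ?R"
    obtain n m where nm: "i = (n, m)" by force
    have "\<not> (0 \<le> n \<and> n * a - K \<le> c * m \<and> c * m \<le> n * (a - 1))"
    proof
      assume h: "0 \<le> n \<and> n * a - K \<le> c * m \<and> c * m \<le> n * (a - 1)"
      then have "n * a - K \<le> n * (a - 1)" by linarith
      then have "n \<le> K" by (simp add: algebra_simps)
      then show False using i h mem[of m n] nm by auto
    qed
    then show "weight \<gamma> x (?p i) = 0" by (auto simp: nm weight_lattice_point)
  qed auto
  also have "\<dots> = (\<Sum>i\<in>Sigma {0..K} ?R. weight \<gamma> x (?p i))"
    by (rule infsum_finite) auto
  also have "\<dots> = (\<Sum>n\<in>{0..K}. \<Sum>m\<in>?R n. weight \<gamma> x (?p (n, m)))"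
    by (subst sum.Sigma) (auto intro!: sum.cong)
  finally show ?thesis by simp
qed

text \<open>In the rows strictly between the base and the apex, boundary points are the endpoints of the row,
  and the count of half-weighted integers applies. The base and the apex consist of boundary points
  only and contain one lattice point each. At the base the count still gives the correct value \<open>1/2\<close>,
  at the apex it gives \<open>0\<close>.\<close>

lemma weight_row:
  fixes n :: int
  assumes dvd: "c dvd K * (a - 1)" and Kc: "K < c" and n: "0 \<le> n" "n \<le> K"
  defines "u \<equiv> of_int (n * a - K) / of_int c :: real" and "v \<equiv> of_int (n * (a - 1)) / of_int c :: real"
  shows "(\<Sum>m\<in>{\<lceil>u\<rceil>..\<lfloor>v\<rfloor>}. weight \<gamma> x (vector [of_int m, of_int n]))
       = v - u - B1_per v + B1_per u + (if n = K then 1 / 2 else 0)"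
proof -
  have mem: "m \<in> {\<lceil>u\<rceil>..\<lfloor>v\<rfloor>} \<longleftrightarrow> n * a - K \<le> c * m \<and> c * m \<le> n * (a - 1)" for m
    using c by (simp only: u_def v_def atLeastAtMost_iff ceiling_le_iff le_floor_iff of_int_divide_cmp)
  have strict: "u < of_int m \<longleftrightarrow> n * a - K < c * m" "of_int m < v \<longleftrightarrow> c * m < n * (a - 1)" for m
    using c by (simp_all only: u_def v_def of_int_divide_cmp)
  have uv: "u < v" if "n < K"
    using that c by (simp add: u_def v_def divide_less_cancel algebra_simps)
  consider "n = 0" | "n = K" | "0 < n" "n < K" using n by linarith
  then show ?thesis
  proof cases
    case 1
    have t: "0 < real_of_int K / of_int c" "real_of_int K / of_int c < 1" using c K Kc by auto
    have u: "u = - (of_int K / of_int c)" and v: "v = 0" using 1 by (simp_all add: u_def v_def)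
    have "\<lceil>u\<rceil> = 0" using t unfolding u by linarith
    moreover have "weight \<gamma> x (vector [of_int 0, of_int n]) = 1 / 2"
      using K by (subst weight_lattice_point) (simp add: 1)
    ultimately show ?thesis
      using 1 K by (simp add: v u B1_per_minus B1_per_unit_interval t)
  next
    case 2
    obtain q where q: "K * (a - 1) = c * q" using dvd by blast
    have "n * a - K = c * q" using q 2 by (simp add: algebra_simps)
    then have u: "u = of_int q" using c by (simp add: u_def)
    have v: "v = of_int q" using c by (simp add: v_def 2 q)
    have "weight \<gamma> x (vector [of_int q, of_int n]) = 1 / 2"
      using K q by (subst weight_lattice_point) (auto simp: 2 algebra_simps)
    then show ?thesis using 2 by (simp add: u v)
  next
    case 3
    have "(\<Sum>m\<in>{\<lceil>u\<rceil>..\<lfloor>v\<rfloor>}. weight \<gamma> x (vector [of_int m, of_int n]))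
        = (\<Sum>m\<in>{\<lceil>u\<rceil>..\<lfloor>v\<rfloor>}. if u < of_int m \<and> of_int m < v then 1 else 1 / 2)"
      using 3 by (intro sum.cong refl) (simp only: weight_lattice_point mem strict, simp)
    then show ?thesis using sum_half_weighted_ints[OF uv] 3 by simp
  qed
qed

lemma infsum_weight:
  assumes "c dvd K * (a - 1)" and "K < c"
  shows "(\<Sum>\<^sub>\<infinity>v\<in>lattice_Z2. weight \<gamma> x v)
     = 1 / 2 + of_int (K * (K + 1)) / of_int (2 * c) - (\<Sum>n\<in>{0..K}. B1_per (of_int (n * a) / of_int c))"
proof -
  have "(\<Sum>\<^sub>\<infinity>v\<in>lattice_Z2. weight \<gamma> x v)
    = (\<Sum>n\<in>{0..K}. of_int (n * (a - 1)) / of_int c - of_int (n * a - K) / of_int c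
        - B1_per (of_int (n * (a - 1)) / of_int c) + B1_per (of_int (n * a - K) / of_int c))
      + (\<Sum>n\<in>{0..K}. if n = K then 1 / 2 else 0)"
    unfolding infsum_weight_rows sum.distrib[symmetric]
    by (intro sum.cong refl weight_row assms) auto
  also have "(\<Sum>n\<in>{0..K}. if n = K then 1 / 2 else 0 :: real) = 1 / 2"
    using K by (subst sum.delta) auto
  finally show ?thesis using sum_rows[OF c K assms(2,1)] by simp
qed

end

section \<open>The difference of the two cocycle values\<close>

lemma B2_per_of_int: "B2_per (of_int k) = 1 / 6"
  by (simp add: B2_per_def)

lemma dedekind_S_second_zero:
  assumes "c > 0" "x $ 2 = 0"
  shows "dedekind_S (- a) c x
       = - (\<Sum>m\<in>{0..<c}. B1_per (of_int (m * a) / of_int c - x $ 1) * B1_per (of_int m / of_int c))"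
proof -
  have arg: "x $ 1 + (x $ 2 + of_int m) * (of_int (- a) / of_int c)
      = - (of_int (m * a) / of_int c - x $ 1)" for m
    by (simp add: assms)
  have "dedekind_S (- a) c x
      = (\<Sum>m\<in>{0..<c}. - (B1_per (of_int (m * a) / of_int c - x $ 1) * B1_per (of_int m / of_int c)))"
    unfolding dedekind_S_def arg B1_per_minus using assms by simp
  then show ?thesis by (simp only: sum_negf)
qed

theorem theorem2:
  fixes a b c d :: int and \<gamma> :: "int ^ 2 ^ 2" and x \<omega> :: "real ^ 2" and \<tau> :: real
  assumes "\<gamma> = vector [vector [a, b], vector [c, d]]"
    and "\<gamma> \<in> SL2Z"
    and "c > 0"
    and "ell \<gamma> > 1"
    and "x $ 1 \<in> \<rat>" and "x $ 2 = 0"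
    and "\<exists>k::int. x $ 1 = of_int k / of_int (ell \<gamma>)"
    and "x $ 1 \<notin> \<int>"
    and "\<omega> \<in> irr_vecs"
    and "\<tau> = \<omega> $ 2 / \<omega> $ 1"
  shows "Z0 \<gamma> x \<omega> - Z0 \<gamma> (real_of_int (ell \<gamma>) *\<^sub>R x) (inverse (real_of_int (ell \<gamma>)) *\<^sub>R \<omega>)
       = (\<Sum>\<^sub>\<infinity>v\<in>lattice_Z2. weight \<gamma> x v)
         - measure lebesgue (triangle_dil \<gamma> x)
         + (sgn (of_int a + of_int c * \<tau>) - 3) / 4"
proof -
  note c = \<open>c > 0\<close>
  define l where "l = ell \<gamma>"
  have \<gamma>: "\<gamma> $ 1 $ 1 = a" "\<gamma> $ 2 $ 1 = c" "\<gamma> $ 1 $ 2 = b" "\<gamma> $ 2 $ 2 = d" using assms(1) by simp_all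
  have l: "l > 1" "l dvd c" "l dvd a - 1" using assms(4) by (simp_all add: l_def ell_def \<gamma>)
  have det: "a * d - b * c = 1" using assms(2) by (simp add: SL2Z_def det_2 \<gamma>)
  have gcd: "gcd a c = 1"
  proof -
    have "gcd a c dvd a * d - b * c" by (intro dvd_diff dvd_mult2 dvd_mult) auto
    then show ?thesis by (simp add: det)
  qed
  obtain k where k: "x $ 1 = of_int k / of_int l" using assms(7) by (auto simp: l_def)
  obtain c' where c': "c = l * c'" using l by blast
  obtain a' where a': "a - 1 = l * a'" using l by blast
  have cx: "of_int c * x $ 1 = of_int (c' * k)" using l by (simp add: k c')
  have lx: "of_int l * x $ 1 = of_int k" using l by (simp add: k)

  \<comment> \<open>The fractional part \<open>(k mod l) / l\<close> of \<open>x\<^sub>1\<close>, written with denominator \<open>c\<close>.\<close>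
  define K where "K = (k mod l) * c'"
  have x_split: "x $ 1 = of_int (k mod l) / of_int l + of_int (k div l)"
  proof -
    have "real_of_int k = of_int l * of_int (k div l) + of_int (k mod l)"
      by (metis mult_div_mod_eq of_int_add of_int_mult)
    then show ?thesis using l by (simp add: k add_divide_distrib)
  qed
  have frac_x: "frac (x $ 1) = of_int K / of_int c"
  proof -
    have "frac (x $ 1) = of_int (k mod l) / of_int l"
      using l unfolding x_split by (simp add: frac_unique_iff)
    moreover have "c' \<noteq> 0" using c c' by auto
    ultimately show ?thesis by (simp add: K_def c')
  qed
  have "frac (x $ 1) > 0" using assms(8) by (simp add: frac_gt_0_iff)
  then have K0: "K > 0" using c by (simp add: frac_x zero_less_divide_iff)
  have Kc: "K < c" using frac_lt_1[of "x $ 1"] c by (simp add: frac_x)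
  have Kdvd: "c dvd K * (a - 1)" unfolding K_def a' c' by simp

  define f where "f = (\<lambda>n. B1_per (of_int (n * a) / of_int c))"
  have S1: "dedekind_S (- a) c x = - (\<Sum>m\<in>{0..<c}. f (m - K) * B1_per (of_int m / of_int c))"
  proof -
    have "B1_per (of_int (m * a) / of_int c - x $ 1) = f (m - K)" for m
    proof -
      have "of_int (m * a) / of_int c - x $ 1 = of_int (m * a - K) / of_int c + of_int (- \<lfloor>x $ 1\<rfloor>)"
        using frac_x by (simp add: frac_def diff_divide_distrib)
      then show ?thesis
        using sawtooth_shift[OF c K0 Kc Kdvd, of m] by (simp only: B1_per_add_int f_def)
    qed
    then show ?thesis using dedekind_S_second_zero[of c x a] c assms(6) by simp
  qed
  \<comment> \<open>Since \<open>l x\<^sub>1\<close> is an integer, this is the classical sum at \<open>0\<close>.\<close>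
  have S2: "dedekind_S (- a) c (of_int l *\<^sub>R x) = - (\<Sum>m\<in>{0..<c}. f m * B1_per (of_int m / of_int c))"
  proof -
    have "B1_per (of_int (m * a) / of_int c - of_int k) = f m" for m
      using B1_per_add_int[of "of_int (m * a) / of_int c" "- k"] by (simp add: f_def)
    then show ?thesis using dedekind_S_second_zero[of c "of_int l *\<^sub>R x" a] c assms(6) lx by simp
  qed
  have S_diff: "dedekind_S (- a) c x - dedekind_S (- a) c (of_int l *\<^sub>R x)
      = (of_int K / of_int c - 1 / 2) / 2 - (\<Sum>n\<in>{0..K}. f n)"
    using dedekind_sum_variation[OF c K0 Kc Kdvd]
    unfolding S1 S2 f_def by (simp add: left_diff_distrib sum_subtractf)

  define j where "j = real_of_int a + of_int c * \<tau>"
  have ratio: "(inverse (of_int l) *\<^sub>R \<omega>) $ 2 / (inverse (of_int l) *\<^sub>R \<omega>) $ 1 = \<tau>"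
    using l by (simp add: assms(10))
  have B2_vals: "B2_per 0 = 1 / 6" "B2_per (of_int c * x $ 1) = 1 / 6"
    "B2_per (of_int c * (of_int l * x $ 1)) = 1 / 6"
    using B2_per_of_int[of 0] by (simp_all only: cx lx B2_per_of_int of_int_0 of_int_mult[symmetric])
  have ind: "indicator \<int> (of_int l * x $ 1) = (1 :: real)" by (simp add: lx)
  have Zx: "Z0 \<gamma> x \<omega> = 1 / (2 * of_int c * j) / 6 + j / (2 * of_int c) / 6 + dedekind_S (- a) c x"
    unfolding Z0_def Let_def assms(10)[symmetric] \<gamma> gcd
    using c assms(6,8) by (simp add: B2_vals j_def)
  have Zlx: "Z0 \<gamma> (of_int l *\<^sub>R x) (inverse (of_int l) *\<^sub>R \<omega>)
      = 1 / (2 * of_int c * j) / 6 + j / (2 * of_int c) / 6 + dedekind_S (- a) c (of_int l *\<^sub>R x) - sgn j / 4"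
    unfolding Z0_def Let_def ratio \<gamma> gcd
    using c assms(6) by (simp add: B2_vals ind sgn_mult j_def)
  have "Z0 \<gamma> x \<omega> - Z0 \<gamma> (of_int l *\<^sub>R x) (inverse (of_int l) *\<^sub>R \<omega>)
      = (of_int K / of_int c - 1 / 2) / 2 - (\<Sum>n\<in>{0..K}. f n) + sgn j / 4"
    using S_diff by (simp add: Zx Zlx)
  moreover have "(\<Sum>\<^sub>\<infinity>v\<in>lattice_Z2. weight \<gamma> x v) - measure lebesgue (triangle_dil \<gamma> x)
      = 1 / 2 + of_int K / of_int c / 2 - (\<Sum>n\<in>{0..K}. f n)"
    using infsum_weight[OF \<gamma>(1,2) c K0 frac_x Kdvd Kc] measure_triangle_dil[OF \<gamma>(1,2) c K0 frac_x] c
    by (simp add: f_def field_simps power2_eq_square)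
  ultimately show ?thesis
    unfolding l_def j_def by (simp add: diff_divide_distrib add_divide_distrib)
qed

end
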